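(* Let $u^1=u^{1j}e_j$, $u^2=u^{2j}e_j$ be $\mathfrak g$-valued matrix functions satisfying the system $$\Delta^j\equiv u^{1j}_2-u^{2j}_1+u^{1k}u^{2l}c^j_{kl}=0,\qquad j=1,\dots,s$$ (in matrix form $\Delta\equiv D_2u^1-D_1u^2+[u^1,u^2]=0$), and let $\Phi[u]$, with values in $G$, be a solution of the linear spectral problem (LSP) $D_\alpha\Phi=u^\alpha\Phi$, $\alpha=1,2$. Let $$\vec v=\sum_{i=1}^3\xi^i[u]\frac{\partial}{\partial x^i}+\sum_{\alpha=1}^2\sum_{j=1}^s\phi^j_\alpha[u]\frac{\partial}{\partial u^{\alpha j}}$$ be a generalized vector field, with evolutionary form $\vec v_Q=\sum_{\alpha,j}Q^j_\alpha[u]\,\partial/\partial u^{\alpha j}$, where $Q^j_\alpha=\phi^j_\alpha-\xi^i u^{\alpha j}_i$, and put $Q_\alpha=Q^j_\alpha e_j\in\mathfrak g$. Then the following are equivalent: (1) $\vec v$ is a generalized symmetry of $\Delta^j=0$; (2) there exists a $\mathfrak g$-valued immersion function $\widetilde F(x^i)=F[u]$ with tangent vectors $\partial\widetilde F/\partial x^\alpha=D_\alpha F[u]=\Phi^{-1}Q_\alpha[u]\Phi$, $\alpha=1,2$; (3) there exists a matrix function $\Psi$ such that the infinitesimal deformation $(u^1,u^2,\Phi)\mapsto(u^1,u^2,\Phi)+\epsilon(Q_1[u],Q_2[u],\Psi)$ is a generalized infinitesimal symmetry of the system $\Delta^j=0$ together with its LSP. Furthermore, if (2) holds then $\Psi=\Phi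 F$ is an admissible infinitesimal deformation of $\Phi$ (i.e. it works in (3)), and if (3) holds then $F=\Phi^{-1}\Psi$ has tangent vectors $D_\alpha F=\Phi^{-1}Q_\alpha\Phi$, $\alpha=1,2$.
   Context: $G$ is a matrix Lie group with Lie algebra $\mathfrak g$ having basis $e_1,\dots,e_s$ and structure constants $[e_k,e_l]=c^j_{kl}e_j$ (repeated indices summed). Independent variables are $x^1,x^2,x^3$ ($x^3=\lambda$ is the spectral parameter); dependent variables are $u^{\alpha j}$, $\alpha=1,2$, $j=1,\dots,s$, with $u^\alpha=u^{\alpha j}e_j$. For a multi-index $J=(j_1,\dots,j_n)$ with $j_k\in\{1,2,3\}$, $u^{\alpha j}_J$ denotes the corresponding partial derivative (jet coordinate); $f[u]$ denotes a function of $x^i$ and finitely many $u^{\alpha j}_J$, and $\widetilde f(x^i)$ its value on a given solution. The total derivatives are $D_i=\partial/\partial x^i+u^{\alpha j}_{J,i}\,\partial/\partial u^{\alpha j}_J$, $D_{J,i}=D_iD_J$. The wave function $\Phi=\Phi[u]$ may depend on $x^i$ and on the jets of $u$. The system $\Delta^j=0$ is assumed nondegenerate. The prolongation of $\vec v_Q$ is $\mathrm{pr}\,\vec v_Q=\sum_J D_JQ^j_\alpha\,\partial/\partial u^{\alpha j}_J$. The vector field $\vec v$ is a generalized symmetry of $\Delta^j=0$ iff $\mathrm{pr}\,\vec v_Q(\Delta)=D_2Q_1-D_1Q_2+[Q_1,u^2]+[u^1,Q_2]=0$ whenever $\Delta=0$. The deformation $(u^1,u^2,\Phi)\mapsto(u^1,u^2,\Phi)+\epsilon(Q_1,Q_2,\Psi)$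 is called a generalized infinitesimal symmetry of the system together with its LSP if $\mathrm{pr}\,\vec v_Q(\Delta)=0$ on solutions of $\Delta=0$, $\Phi+\epsilon\Psi$ lies in $G$ to first order in $\epsilon$ (i.e. $\Phi^{-1}\Psi\in\mathfrak g$), and $D_\alpha\Psi=u^\alpha\Psi+Q_\alpha\Phi$ for $\alpha=1,2$. An immersion function with given tangent vectors is a $\mathfrak g$-valued function whose derivatives $D_1F,D_2F$ are the prescribed ones (determined up to an additive constant). *)

theory Defs
  imports "HOL-Analysis.Analysis"
begin

type_synonym 'n cmat = "complex^'n^'n"

text \<open>Matrix Lie group: a subgroup of GL(n,C) that is closed in GL(n,C).\<close>
definition matrix_Lie_group :: "'n::finite cmat set \<Rightarrow> bool" where
  "matrix_Lie_group G \<longleftrightarrow>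
     G \<subseteq> {A. invertible A} \<and> mat 1 \<in> G \<and>
     (\<forall>A\<in>G. \<forall>B\<in>G. A ** B \<in> G) \<and> (\<forall>A\<in>G. matrix_inv A \<in> G) \<and>
     closedin (top_of_set {A. invertible A}) G"

text \<open>Lie algebra of a matrix Lie group: tangent vectors at the identity of
  curves in G (a real vector space of matrices).\<close>
definition lie_algebra :: "'n::finite cmat set \<Rightarrow> 'n cmat set" where
  "lie_algebra G = {X. \<exists>\<gamma>::real \<Rightarrow> 'n cmat. (\<forall>t. \<gamma> t \<in> G) \<and> \<gamma> 0 = mat 1 \<and>
                          (\<gamma> has_vector_derivative X) (at 0)}"

definition lie_bracket :: "'n::finite cmat \<Rightarrow> 'n cmat \<Rightarrow> 'n cmat" where
  "lie_bracket A B = A ** B - B ** A"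

text \<open>Partial derivative in the direction x^i of a function of (x^1,x^2,x^3).\<close>
definition has_partial ::
  "3 \<Rightarrow> (real^3 \<Rightarrow> 'a::real_normed_vector) \<Rightarrow> real^3 \<Rightarrow> 'a \<Rightarrow> bool" where
  "has_partial i f x D \<longleftrightarrow> ((\<lambda>t. f (x + t *\<^sub>R axis i 1)) has_vector_derivative D) (at 0)"

definition partial :: "3 \<Rightarrow> (real^3 \<Rightarrow> 'a::real_normed_vector) \<Rightarrow> real^3 \<Rightarrow> 'a" where
  "partial i f x = vector_derivative (\<lambda>t. f (x + t *\<^sub>R axis i 1)) (at 0)"

text \<open>Continuously (Frechet) differentiable on all of R^3.\<close>
definition C1 :: "(real^3 \<Rightarrow> 'a::real_normed_vector) \<Rightarrow> bool" where
  "C1 f \<longleftrightarrow> (\<forall>x. f differentiable at x) \<and>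
            continuous_on UNIV (\<lambda>x. frechet_derivative f (at x))"

text \<open>The linearized system pr v_Q(Delta) = 0 evaluated on the solution (u1,u2).\<close>
definition sym_condition ::
  "(real^3 \<Rightarrow> 'n::finite cmat) \<Rightarrow> (real^3 \<Rightarrow> 'n cmat) \<Rightarrow>
   (real^3 \<Rightarrow> 'n cmat) \<Rightarrow> (real^3 \<Rightarrow> 'n cmat) \<Rightarrow> bool" where
  "sym_condition u1 u2 Q1 Q2 \<longleftrightarrow>
     (\<forall>x. partial 2 Q1 x - partial 1 Q2 x + lie_bracket (Q1 x) (u2 x)
           + lie_bracket (u1 x) (Q2 x) = 0)"

end

(*
  Conjugation by the wave function turns the linearised zero-curvature expression into a curl:
  since D_a Phi = u^a Phi, the fields A_a = Phi^-1 Q_a Phi satisfy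
    D_2 A_1 - D_1 A_2 = Phi^-1 (D_2 Q_1 - D_1 Q_2 + [Q_1, u^2] + [u^1, Q_2]) Phi.
  So v is a symmetry iff the g-valued form A_1 dx^1 + A_2 dx^2 is closed, i.e. (by the symmetry of
  mixed partials and the Poincare lemma in the (x^1, x^2)-planes) iff it has a potential F; the
  potential takes values in g because the integrals defining it stay in the subspace g, and the
  A_a lie in g because g is Ad(G)-invariant.  Finally the product rule together with the LSP shows
  that D_a F = Phi^-1 Q_a Phi holds iff Psi = Phi F satisfies D_a Psi = u^a Psi + Q_a Phi.
*)
theory Submission
  imports Defs
begin

subsection \<open>Matrix multiplication and inversion\<close>

lemma bounded_bilinear_matrix_mult:
  "bounded_bilinear ((**) :: 'a::{real_normed_field,euclidean_space}^'n::finite^'m::finite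
    \<Rightarrow> 'a^'p::finite^'n \<Rightarrow> 'a^'p^'m)"
proof -
  have "bilinear ((**) :: 'a^'n^'m \<Rightarrow> 'a^'p^'n \<Rightarrow> 'a^'p^'m)"
    unfolding bilinear_def
    by (auto simp: linear_iff vec_eq_iff matrix_matrix_mult_def sum.distrib scaleR_sum_right algebra_simps)
  then show ?thesis
    using bilinear_conv_bounded_bilinear by blast
qed

interpretation matrix_mult: bounded_bilinear
  "(**) :: 'a::{real_normed_field,euclidean_space}^'n::finite^'m::finite
    \<Rightarrow> 'a^'p::finite^'n \<Rightarrow> 'a^'p^'m"
  by (rule bounded_bilinear_matrix_mult)

lemma matrix_inv_right: "invertible A \<Longrightarrow> A ** matrix_inv A = mat 1"
  and matrix_inv_left: "invertible A \<Longrightarrow> matrix_inv A ** A = mat 1"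
  unfolding invertible_def matrix_inv_def by (metis (mono_tags, lifting) someI_ex)+

lemma matrix_inv_cramer:
  fixes A :: "'a::field^'n::finite^'n"
  assumes "invertible A"
  shows "matrix_inv A = (\<chi> k j. det (\<chi> i l. if l = k then axis j 1 $ i else A$i$l) / det A)"
proof -
  have "matrix_inv A $ k $ j = det (\<chi> i l. if l = k then axis j 1 $ i else A$i$l) / det A" for k j
  proof -
    have "A *v (matrix_inv A *v axis j 1) = axis j 1"
      by (simp add: matrix_vector_mul_assoc matrix_inv_right[OF assms])
    then have "matrix_inv A *v axis j 1 = (\<chi> k. det (\<chi> i l. if l = k then axis j 1 $ i else A$i$l) / det A)"
      using cramer assms invertible_det_nz by blast
    moreover have "(matrix_inv A *v axis j 1) $ k = matrix_inv A $ k $ j"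
      by (simp add: matrix_vector_mult_def axis_def if_distrib cong: if_cong)
    ultimately show ?thesis by simp
  qed
  then show ?thesis by (simp add: vec_eq_iff)
qed

lemma continuous_on_det [continuous_intros]:
  "continuous_on S f \<Longrightarrow> continuous_on S (\<lambda>y. det (f y :: 'a::real_normed_field^'n::finite^'n))"
  unfolding det_def by (intro continuous_intros)

lemma open_invertible: "open {A :: 'a::real_normed_field^'n::finite^'n. invertible A}"
  using open_Collect_neq[OF continuous_on_det[OF continuous_on_id] continuous_on_const]
  by (simp add: invertible_det_nz)

lemma continuous_on_matrix_inv:
  "continuous_on {A :: 'a::real_normed_field^'n::finite^'n. invertible A} matrix_inv"
proof -
  have "continuous_on S (\<lambda>A :: 'a^'n^'n. if l = k then c else A$i$l)" for S k l i c
    by (cases "l = k") (auto intro!: continuous_intros)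
  then have "continuous_on {A. invertible A}
      (\<lambda>A :: 'a^'n^'n. \<chi> k j. det (\<chi> i l. if l = k then axis j 1 $ i else A$i$l) / det A)"
    by (intro continuous_intros continuous_on_vec_lambda) (auto simp: invertible_det_nz)
  then show ?thesis
    by (rule continuous_on_cong[THEN iffD1, rotated 2]) (simp_all add: matrix_inv_cramer)
qed

lemma has_derivative_matrix_inv':
  fixes A :: "'a::{real_normed_field,euclidean_space}^'n::finite^'n"
  assumes A: "invertible A"
  shows "(matrix_inv has_derivative (\<lambda>H. - (matrix_inv A ** H ** matrix_inv A))) (at A within S)"
proof -
  obtain e where e: "e > 0" "ball A e \<subseteq> {B. invertible B}"
    using open_invertible A by (metis mem_Collect_eq open_contains_ball)
  obtain K where K: "K > 0" "\<And>(X :: 'a^'n^'n) (Y :: 'a^'n^'n). norm (X ** Y) \<le> norm X * norm Y * K"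
    using matrix_mult.pos_bounded by blast
  have "isCont matrix_inv A"
    using continuous_on_matrix_inv open_invertible A continuous_on_eq_continuous_at by blast
  then have lim: "((\<lambda>B. norm (matrix_inv B - matrix_inv A) * norm (matrix_inv A) * K * K) \<longlongrightarrow> 0) (at A within S)"
    by (intro tendsto_mult_left_zero tendsto_norm_zero)
       (simp add: LIM_zero_iff continuous_within isCont_def tendsto_within_subset[OF _ subset_UNIV])
  show ?thesis
  proof (rule has_derivativeI_sandwich[OF e(1) _ _ lim])
    show "bounded_linear (\<lambda>H. - (matrix_inv A ** H ** matrix_inv A))"
      by (intro bounded_linear_minus bounded_linear_compose[OF matrix_mult.bounded_linear_left]
          matrix_mult.bounded_linear_right)
  next
    fix B assume "B \<noteq> A" "dist B A < e"
    then have B: "invertible B" using e(2) by (auto simp: dist_commute)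
    have cancel: "matrix_inv B ** A ** matrix_inv A = matrix_inv B"
        "matrix_inv A ** A ** matrix_inv A = matrix_inv A"
      by (simp_all flip: matrix_mul_assoc add: matrix_inv_right A)
    have expand: "(matrix_inv B - matrix_inv A) ** (B - A) ** matrix_inv A
        = (matrix_inv A - matrix_inv B) - (matrix_inv A ** B ** matrix_inv A - matrix_inv A)"
      by (simp only: matrix_mult.diff_left matrix_mult.diff_right matrix_inv_left A B
          matrix_mul_lid cancel) (simp add: algebra_simps)
    have "matrix_inv A ** (B - A) ** matrix_inv A = matrix_inv A ** B ** matrix_inv A - matrix_inv A"
      by (simp only: matrix_mult.diff_left matrix_mult.diff_right cancel(2))
    then have "matrix_inv B - matrix_inv A + matrix_inv A ** (B - A) ** matrix_inv A
        = - ((matrix_inv B - matrix_inv A) ** (B - A) ** matrix_inv A)"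
      unfolding expand by (simp add: algebra_simps)
    then have "norm (matrix_inv B - matrix_inv A + matrix_inv A ** (B - A) ** matrix_inv A)
        = norm ((matrix_inv B - matrix_inv A) ** (B - A) ** matrix_inv A)"
      by simp
    also have "\<dots> \<le> norm ((matrix_inv B - matrix_inv A) ** (B - A)) * norm (matrix_inv A) * K"
      by (rule K(2))
    also have "\<dots> \<le> norm (matrix_inv B - matrix_inv A) * norm (B - A) * K * norm (matrix_inv A) * K"
      using K by (intro mult_right_mono K(2)) auto
    finally show "norm (matrix_inv B - matrix_inv A - - (matrix_inv A ** (B - A) ** matrix_inv A)) / norm (B - A)
        \<le> norm (matrix_inv B - matrix_inv A) * norm (matrix_inv A) * K * K"
      using \<open>B \<noteq> A\<close> by (simp add: divide_le_eq ac_simps)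
  qed
qed

lemma has_derivative_matrix_inv [derivative_intros]:
  fixes f :: "_ \<Rightarrow> 'a::{real_normed_field,euclidean_space}^'n::finite^'n"
  assumes "invertible (f x)" and "(f has_derivative f') (at x within S)"
  shows "((\<lambda>x. matrix_inv (f x)) has_derivative
      (\<lambda>h. - (matrix_inv (f x) ** f' h ** matrix_inv (f x)))) (at x within S)"
  using has_derivative_compose[OF assms(2) has_derivative_matrix_inv'[OF assms(1)]] .

subsection \<open>Partial derivatives and \<open>C\<^sup>1\<close> functions\<close>

lemma has_partial_compose:
  assumes "has_partial i f x D" and "(g has_derivative g') (at (f x))"
  shows "has_partial i (\<lambda>y. g (f y)) x (g' D)"
  using assms unfolding has_partial_def has_vector_derivative_def
  by (auto dest: has_derivative_compose simp: linear_simps has_derivative_bounded_linear)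

lemma has_partial_matrix_inv:
  fixes f :: "real^3 \<Rightarrow> 'a::{real_normed_field,euclidean_space}^'n::finite^'n"
  assumes "has_partial i f x D" and "invertible (f x)"
  shows "has_partial i (\<lambda>y. matrix_inv (f y)) x (- (matrix_inv (f x) ** D ** matrix_inv (f x)))"
  using has_partial_compose[OF assms(1) has_derivative_matrix_inv'[OF assms(2)]] .

lemma has_partial_matrix_mult:
  fixes f g :: "real^3 \<Rightarrow> 'a::{real_normed_field,euclidean_space}^'n::finite^'n"
  assumes "has_partial i f x A" and "has_partial i g x B"
  shows "has_partial i (\<lambda>y. f y ** g y) x (f x ** B + A ** g x)"
  using matrix_mult.has_vector_derivative[OF assms[unfolded has_partial_def]]
  unfolding has_partial_def by simp

lemma has_vector_derivative_along_line:
  assumes "(f has_derivative f') (at (y + t0 *\<^sub>R v))"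
  shows "((\<lambda>t. f (y + t *\<^sub>R v)) has_vector_derivative f' v) (at t0)"
proof -
  have "((\<lambda>t. y + t *\<^sub>R v) has_derivative (\<lambda>t. t *\<^sub>R v)) (at t0)"
    by (auto intro!: derivative_eq_intros)
  from has_derivative_compose[OF this assms] show ?thesis
    using has_derivative_bounded_linear[OF assms]
    by (simp add: has_vector_derivative_def linear_simps)
qed

lemma has_derivative_imp_has_partial:
  "(f has_derivative f') (at x) \<Longrightarrow> has_partial i f x (f' (axis i 1))"
  unfolding has_partial_def using has_vector_derivative_along_line[of f f' x 0] by simp

lemma partial_eqI: "has_partial i f x D \<Longrightarrow> partial i f x = D"
  unfolding has_partial_def partial_def by (rule vector_derivative_at)

lemma partial_eq_derivative: "(f has_derivative f') (at x) \<Longrightarrow> partial i f x = f' (axis i 1)"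
  using partial_eqI[OF has_derivative_imp_has_partial] .

lemma C1_has_derivative: "C1 f \<Longrightarrow> (f has_derivative frechet_derivative f (at x)) (at x)"
  unfolding C1_def using frechet_derivative_works by blast

lemma C1_continuous_derivative:
  "C1 f \<Longrightarrow> continuous_on UNIV (\<lambda>x. frechet_derivative f (at x) v)"
  unfolding C1_def by (auto intro: continuous_on_product_then_coordinatewise)

lemma C1I:
  assumes "\<And>x. (f has_derivative f' x) (at x)" and "\<And>v. continuous_on UNIV (\<lambda>x. f' x v)"
  shows "C1 f"
proof -
  have "frechet_derivative f (at x) = f' x" for x
    using assms(1) frechet_derivative_at by metis
  then show ?thesis
    unfolding C1_def using assms by (auto intro: differentiableI continuous_on_coordinatewise_then_product)
qed

lemma C1_continuous: "C1 f \<Longrightarrow> continuous_on UNIV f"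
  unfolding C1_def by (simp add: differentiable_imp_continuous_on differentiable_on_def)

lemma C1_has_partial: "C1 f \<Longrightarrow> has_partial i f x (partial i f x)"
  using has_derivative_imp_has_partial[OF C1_has_derivative] partial_eqI by metis

lemma C1_matrix_mult:
  fixes f g :: "real^3 \<Rightarrow> 'a::{real_normed_field,euclidean_space}^'n::finite^'n"
  assumes "C1 f" and "C1 g"
  shows "C1 (\<lambda>x. f x ** g x)"
  by (rule C1I[OF matrix_mult.FDERIV[OF C1_has_derivative C1_has_derivative, OF assms]])
    (intro continuous_intros matrix_mult.continuous_on C1_continuous C1_continuous_derivative assms)

lemma C1_matrix_inv:
  fixes f :: "real^3 \<Rightarrow> 'a::{real_normed_field,euclidean_space}^'n::finite^'n"
  assumes "C1 f" and "\<And>x. invertible (f x)"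
  shows "C1 (\<lambda>x. matrix_inv (f x))"
proof (rule C1I)
  show "((\<lambda>x. matrix_inv (f x)) has_derivative
      (\<lambda>h. - (matrix_inv (f x) ** frechet_derivative f (at x) h ** matrix_inv (f x)))) (at x)" for x
    by (intro has_derivative_matrix_inv assms C1_has_derivative)
  have "continuous_on UNIV (\<lambda>x. matrix_inv (f x))"
    using continuous_on_compose2[OF continuous_on_matrix_inv C1_continuous[OF assms(1)]] assms(2) by blast
  then show "continuous_on UNIV (\<lambda>x. - (matrix_inv (f x) ** frechet_derivative f (at x) v ** matrix_inv (f x)))" for v
    by (intro continuous_intros matrix_mult.continuous_on C1_continuous_derivative assms)
qed

subsection \<open>The Lie algebra of a matrix Lie group\<close>

lemma matrix_Lie_group_invertible:
  "matrix_Lie_group G \<Longrightarrow> g \<in> G \<Longrightarrow> invertible g"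
  unfolding matrix_Lie_group_def by blast

lemma lie_algebra_subspace:
  assumes G: "matrix_Lie_group G"
  shows "subspace (lie_algebra G)"
  unfolding subspace_def
proof (intro conjI ballI allI)
  show "0 \<in> lie_algebra G"
    unfolding lie_algebra_def using G
    by (intro CollectI exI[of _ "\<lambda>_. mat 1"]) (auto simp: matrix_Lie_group_def)
next
  fix X Y assume "X \<in> lie_algebra G" "Y \<in> lie_algebra G"
  then obtain \<gamma> \<delta> where \<gamma>: "\<forall>t. \<gamma> t \<in> G" "\<gamma> 0 = mat 1" "(\<gamma> has_vector_derivative X) (at 0)"
    and \<delta>: "\<forall>t. \<delta> t \<in> G" "\<delta> 0 = mat 1" "(\<delta> has_vector_derivative Y) (at 0)"
    unfolding lie_algebra_def by blast
  have "((\<lambda>t. \<gamma> t ** \<delta> t) has_vector_derivative \<gamma> 0 ** Y + X ** \<delta> 0) (at 0)"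
    by (rule matrix_mult.has_vector_derivative[OF \<gamma>(3) \<delta>(3)])
  then show "X + Y \<in> lie_algebra G"
    unfolding lie_algebra_def using \<gamma> \<delta> G
    by (intro CollectI exI[of _ "\<lambda>t. \<gamma> t ** \<delta> t"]) (auto simp: matrix_Lie_group_def add.commute)
next
  fix c :: real and X assume "X \<in> lie_algebra G"
  then obtain \<gamma> where \<gamma>: "\<forall>t. \<gamma> t \<in> G" "\<gamma> 0 = mat 1" "(\<gamma> has_vector_derivative X) (at 0)"
    unfolding lie_algebra_def by blast
  have "((\<lambda>t::real. c * t) has_vector_derivative c) (at 0)"
    using has_real_derivative_iff_has_vector_derivative by (auto intro!: derivative_eq_intros)
  then have "((\<gamma> \<circ> (\<lambda>t. c * t)) has_vector_derivative c *\<^sub>R X) (at 0)"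
    by (rule vector_diff_chain_at) (simp add: \<gamma>)
  then show "c *\<^sub>R X \<in> lie_algebra G"
    unfolding lie_algebra_def using \<gamma>
    by (intro CollectI exI[of _ "\<lambda>t. \<gamma> (c * t)"]) (auto simp: o_def)
qed

lemma lie_algebra_conj:
  assumes G: "matrix_Lie_group G" and X: "X \<in> lie_algebra G" and g: "g \<in> G"
  shows "matrix_inv g ** X ** g \<in> lie_algebra G"
proof -
  obtain \<gamma> where \<gamma>: "\<forall>t. \<gamma> t \<in> G" "\<gamma> 0 = mat 1" "(\<gamma> has_vector_derivative X) (at 0)"
    using X unfolding lie_algebra_def by blast
  have "bounded_linear (\<lambda>M. matrix_inv g ** M ** g)"
    by (intro bounded_linear_compose[OF matrix_mult.bounded_linear_left] matrix_mult.bounded_linear_right)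
  from bounded_linear.has_vector_derivative[OF this \<gamma>(3)]
  have "((\<lambda>t. matrix_inv g ** \<gamma> t ** g) has_vector_derivative matrix_inv g ** X ** g) (at 0)" .
  moreover have "matrix_inv g ** \<gamma> t ** g \<in> G" for t
    using G \<gamma>(1) g unfolding matrix_Lie_group_def by auto
  moreover have "matrix_inv g ** \<gamma> 0 ** g = mat 1"
    using \<gamma>(2) matrix_inv_left[OF matrix_Lie_group_invertible[OF G g]] by simp
  ultimately show ?thesis
    unfolding lie_algebra_def by (intro CollectI exI[of _ "\<lambda>t. matrix_inv g ** \<gamma> t ** g"]) blast
qed

subsection \<open>Mixed partials and the Poincare lemma in the \<open>(x\<^sup>1, x\<^sup>2)\<close>-planes\<close>

lemma has_vector_derivative_translate:
  assumes "(f has_vector_derivative D) (at (a + t))"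
  shows "((\<lambda>s. f (a + s)) has_vector_derivative D) (at t)"
proof -
  have "((\<lambda>s. a + s) has_vector_derivative 1) (at t)"
    by (auto intro!: derivative_eq_intros)
  from vector_diff_chain_at[OF this] show ?thesis
    using assms by (simp add: o_def)
qed

lemma has_partial_translate:
  "has_partial i F y D \<Longrightarrow> ((\<lambda>\<tau>. F (y + (\<tau> - \<tau>0) *\<^sub>R axis i 1)) has_vector_derivative D) (at \<tau>0)"
  using has_vector_derivative_translate[of "\<lambda>h. F (y + h *\<^sub>R axis i 1)" D "- \<tau>0" \<tau>0]
  by (simp add: has_partial_def)

lemma has_vector_derivative_along_scaled_line:
  assumes "(A has_derivative A') (at (y + (c * t0) *\<^sub>R v))"
  shows "((\<lambda>t. A (y + (c * t) *\<^sub>R v)) has_vector_derivative c *\<^sub>R A' v) (at t0)"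
  using has_vector_derivative_along_line[of A A' y t0 "c *\<^sub>R v"] assms
    has_derivative_bounded_linear[OF assms]
  by (simp add: linear_simps mult.commute)

lemma has_partial_integral:
  fixes F A :: "real^3 \<Rightarrow> 'v::euclidean_space"
  assumes F: "\<And>x. has_partial i F x (A x)" and s: "0 \<le> s"
  shows "F (y + s *\<^sub>R axis i 1) - F y = integral {0..s} (\<lambda>\<tau>. A (y + \<tau> *\<^sub>R axis i 1))"
proof -
  have "((\<lambda>\<tau>. F (y + \<tau> *\<^sub>R axis i 1)) has_vector_derivative A (y + \<tau> *\<^sub>R axis i 1)) (at \<tau> within {0..s})" for \<tau>
    using has_partial_translate[OF F[of "y + \<tau> *\<^sub>R axis i 1"], of \<tau>]
    by (simp add: algebra_simps has_vector_derivative_at_within)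
  then have "((\<lambda>\<tau>. A (y + \<tau> *\<^sub>R axis i 1)) has_integral F (y + s *\<^sub>R axis i 1) - F (y + 0 *\<^sub>R axis i 1)) {0..s}"
    by (intro fundamental_theorem_of_calculus s)
  then show ?thesis
    by (simp add: integral_unique)
qed

lemma has_vector_derivative_parametric_integral:
  fixes A :: "real^3 \<Rightarrow> 'v::euclidean_space"
  assumes A: "C1 A"
  shows "((\<lambda>t. integral {a..b} (\<lambda>\<tau>. A (y + \<tau> *\<^sub>R u + t *\<^sub>R w))) has_vector_derivative
      integral {a..b} (\<lambda>\<tau>. frechet_derivative A (at (y + \<tau> *\<^sub>R u + t0 *\<^sub>R w)) w)) (at t0)"
proof -
  have "((\<lambda>t. integral (cbox a b) (\<lambda>\<tau>. A (y + \<tau> *\<^sub>R u + t *\<^sub>R w))) has_vector_derivative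
      integral (cbox a b) (\<lambda>\<tau>. frechet_derivative A (at (y + \<tau> *\<^sub>R u + t0 *\<^sub>R w)) w)) (at t0 within UNIV)"
  proof (rule leibniz_rule_vector_derivative)
    fix t \<tau> :: real
    show "((\<lambda>t. A (y + \<tau> *\<^sub>R u + t *\<^sub>R w)) has_vector_derivative
        frechet_derivative A (at (y + \<tau> *\<^sub>R u + t *\<^sub>R w)) w) (at t within UNIV)"
      by (rule has_vector_derivative_along_line) (rule C1_has_derivative[OF A])
  next
    show "(\<lambda>\<tau>. A (y + \<tau> *\<^sub>R u + t *\<^sub>R w)) integrable_on cbox a b" for t
      by (intro integrable_continuous continuous_on_compose2[OF C1_continuous[OF A]] continuous_intros) auto
  next
    have "continuous_on (UNIV \<times> cbox a b)
        (\<lambda>z. frechet_derivative A (at (y + snd z *\<^sub>R u + fst z *\<^sub>R w)) w)"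
      by (intro continuous_on_compose2[OF C1_continuous_derivative[OF A]] continuous_intros) auto
    then show "continuous_on (UNIV \<times> cbox a b)
        (\<lambda>(t, \<tau>). frechet_derivative A (at (y + \<tau> *\<^sub>R u + t *\<^sub>R w)) w)"
      by (simp add: split_beta)
  qed auto
  then show ?thesis
    by simp
qed

lemma increment_of_partial_eq_integral:
  fixes F A1 A2 :: "real^3 \<Rightarrow> 'v::euclidean_space"
  assumes F1: "\<And>x. has_partial 1 F x (A1 x)" and F2: "\<And>x. has_partial 2 F x (A2 x)"
    and A1: "C1 A1" and s: "0 \<le> s"
  shows "A2 (x + s *\<^sub>R axis 1 1) - A2 x
    = integral {0..s} (\<lambda>\<tau>. frechet_derivative A1 (at (x + \<tau> *\<^sub>R axis 1 1)) (axis 2 1))"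
proof -
  \<comment> \<open>Differentiate \<open>F (x + s e\<^sub>1 + t e\<^sub>2) - F (x + t e\<^sub>2) = \<integral>\<^sub>0\<^sup>s A1 (x + \<tau> e\<^sub>1 + t e\<^sub>2) d\<tau>\<close> in \<open>t\<close> at \<open>0\<close>.\<close>
  have "((\<lambda>t. F (x + s *\<^sub>R axis 1 1 + t *\<^sub>R axis 2 1) - F (x + t *\<^sub>R axis 2 1)) has_vector_derivative
      A2 (x + s *\<^sub>R axis 1 1) - A2 x) (at 0)"
    using has_partial_translate[OF F2, of "x + s *\<^sub>R axis 1 1" 0] has_partial_translate[OF F2, of x 0]
    by (auto intro!: derivative_eq_intros)
  moreover have "F (x + s *\<^sub>R axis 1 1 + t *\<^sub>R axis 2 1) - F (x + t *\<^sub>R axis 2 1)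
      = integral {0..s} (\<lambda>\<tau>. A1 (x + \<tau> *\<^sub>R axis 1 1 + t *\<^sub>R axis 2 1))" for t
    using has_partial_integral[OF F1 s, of "x + t *\<^sub>R axis 2 1"] by (simp add: algebra_simps)
  ultimately have "((\<lambda>t. integral {0..s} (\<lambda>\<tau>. A1 (x + \<tau> *\<^sub>R axis 1 1 + t *\<^sub>R axis 2 1)))
      has_vector_derivative A2 (x + s *\<^sub>R axis 1 1) - A2 x) (at 0)"
    by simp
  from vector_derivative_unique_at[OF this has_vector_derivative_parametric_integral[OF A1]]
  show ?thesis
    by simp
qed

lemma mixed_partials_commute:
  fixes F A1 A2 :: "real^3 \<Rightarrow> 'v::euclidean_space"
  assumes F1: "\<And>x. has_partial 1 F x (A1 x)" and F2: "\<And>x. has_partial 2 F x (A2 x)"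
    and A1: "C1 A1" and A2: "C1 A2"
  shows "partial 2 A1 x = partial 1 A2 x"
proof -
  define e1 :: "real^3" where "e1 = axis 1 1"
  define D2A1 where "D2A1 y = frechet_derivative A1 (at y) (axis 2 1)" for y
  have A2_line: "((\<lambda>s. A2 (x + s *\<^sub>R e1)) has_vector_derivative frechet_derivative A2 (at x) e1) (at 0)"
    using has_vector_derivative_along_line[of A2 _ x 0 e1, OF C1_has_derivative[OF A2]] by simp
  have "((\<lambda>s. A2 (x + s *\<^sub>R e1) - A2 x) has_vector_derivative frechet_derivative A2 (at x) e1)
      (at 0 within {0..1})"
    by (rule has_vector_derivative_at_within[OF has_vector_derivative_diff_const[THEN iffD2, OF A2_line]])
  moreover have "((\<lambda>s. A2 (x + s *\<^sub>R e1) - A2 x) has_vector_derivative D2A1 x) (at 0 within {0..1})"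
  proof -
    have "continuous_on {0..1} (\<lambda>\<tau>. D2A1 (x + \<tau> *\<^sub>R e1))"
      unfolding D2A1_def
      by (intro continuous_on_compose2[OF C1_continuous_derivative[OF A1]] continuous_intros) auto
    from integral_has_vector_derivative[OF this, of 0]
    have "((\<lambda>s. integral {0..s} (\<lambda>\<tau>. D2A1 (x + \<tau> *\<^sub>R e1))) has_vector_derivative D2A1 x)
        (at 0 within {0..1})"
      by simp
    then show ?thesis
      by (rule has_vector_derivative_transform[rotated 2])
        (auto simp: D2A1_def e1_def increment_of_partial_eq_integral[OF F1 F2 A1])
  qed
  ultimately have "frechet_derivative A2 (at x) e1 = D2A1 x"
    by (rule vector_derivative_unique_within_closed_interval[of 0 1 0, unfolded cbox_interval, rotated 2]) auto
  then show ?thesis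
    by (simp add: D2A1_def e1_def partial_eq_derivative[OF C1_has_derivative] A1 A2)
qed

lemma has_vector_derivative_integral_along_ray:
  fixes A :: "real^3 \<Rightarrow> 'v::euclidean_space"
  assumes "C1 A"
  shows "((\<lambda>s. integral {0..1} (\<lambda>r. s *\<^sub>R A (y + (r * s) *\<^sub>R v))) has_vector_derivative A (y + s0 *\<^sub>R v)) (at s0)"
proof -
  define A' where "A' z = frechet_derivative A (at z)" for z
  have d: "(A has_derivative A' z) (at z)" and c: "continuous_on UNIV (\<lambda>z. A' z v)" for z v
    unfolding A'_def using assms by (simp_all add: C1_has_derivative C1_continuous_derivative)
  have contA: "continuous_on UNIV A" using assms by (rule C1_continuous)
  \<comment> \<open>\<open>fx s r\<close> is both \<open>\<partial>\<^sub>s (s A (y + r s v))\<close> and \<open>\<partial>\<^sub>r (r A (y + r s v))\<close>: the Leibniz rule and the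
    fundamental theorem of calculus then give the claim.\<close>
  define fx where "fx s r = A (y + (r * s) *\<^sub>R v) + (s * r) *\<^sub>R A' (y + (r * s) *\<^sub>R v) v" for s r
  have R: "((\<lambda>s. integral (cbox 0 1) (\<lambda>r. s *\<^sub>R A (y + (r * s) *\<^sub>R v))) has_vector_derivative
            integral (cbox 0 1) (fx s0)) (at s0 within UNIV)"
  proof (rule leibniz_rule_vector_derivative[where fx=fx])
    fix s r :: real
    have "((\<lambda>s. A (y + (r * s) *\<^sub>R v)) has_vector_derivative r *\<^sub>R A' (y + (r * s) *\<^sub>R v) v) (at s)"
      by (rule has_vector_derivative_along_scaled_line[OF d])
    from has_vector_derivative_scaleR[OF DERIV_ident this]
    show "((\<lambda>s. s *\<^sub>R A (y + (r * s) *\<^sub>R v)) has_vector_derivative fx s r) (at s within UNIV)"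
      by (rule has_vector_derivative_eq_rhs) (simp add: fx_def algebra_simps)
  next
    fix s :: real
    show "(\<lambda>r. s *\<^sub>R A (y + (r * s) *\<^sub>R v)) integrable_on cbox 0 1"
      by (rule integrable_continuous) (intro continuous_intros continuous_on_compose2[OF contA], auto)
  next
    have "continuous_on (UNIV \<times> cbox 0 1) (\<lambda>z. fx (fst z) (snd z))"
      unfolding fx_def
      by (intro continuous_intros continuous_on_compose2[OF contA] continuous_on_compose2[OF c])
         (auto intro: continuous_on_fst[OF continuous_on_id] continuous_on_snd[OF continuous_on_id])
    then show "continuous_on (UNIV \<times> cbox 0 1) (\<lambda>(s, r). fx s r)" by (simp add: split_beta)
  qed auto
  have "((\<lambda>r. r *\<^sub>R A (y + (s0 * r) *\<^sub>R v)) has_vector_derivative fx s0 r) (at r within {0..1})" for r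
  proof -
    have "((\<lambda>r. A (y + (s0 * r) *\<^sub>R v)) has_vector_derivative s0 *\<^sub>R A' (y + (s0 * r) *\<^sub>R v) v) (at r)"
      by (rule has_vector_derivative_along_scaled_line[OF d])
    from has_vector_derivative_scaleR[OF DERIV_ident this]
    show ?thesis
      by (rule has_vector_derivative_at_within[OF has_vector_derivative_eq_rhs]) (simp add: fx_def algebra_simps)
  qed
  then have "(fx s0 has_integral (1 *\<^sub>R A (y + (s0 * 1) *\<^sub>R v) - 0 *\<^sub>R A (y + (s0 * 0) *\<^sub>R v))) {0..1}"
    by (intro fundamental_theorem_of_calculus) auto
  then have "integral {0..1} (fx s0) = A (y + s0 *\<^sub>R v)" by (simp add: integral_unique)
  with R show ?thesis by simp
qed

lemma integral_derivative_along_segment: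
  fixes A :: "real^3 \<Rightarrow> 'v::euclidean_space"
  assumes "C1 A"
  shows "integral {0..1} (\<lambda>r. frechet_derivative A (at (y + r *\<^sub>R v)) v) = A (y + v) - A y"
proof -
  have "((\<lambda>r. A (y + r *\<^sub>R v)) has_vector_derivative frechet_derivative A (at (y + r *\<^sub>R v)) v)
      (at r within {0..1})" for r
    by (rule has_vector_derivative_at_within[OF has_vector_derivative_along_line[OF C1_has_derivative[OF assms]]])
  then have "((\<lambda>r. frechet_derivative A (at (y + r *\<^sub>R v)) v) has_integral
      A (y + 1 *\<^sub>R v) - A (y + 0 *\<^sub>R v)) {0..1}"
    by (intro fundamental_theorem_of_calculus) auto
  then show ?thesis
    by (simp add: integral_unique)
qed

lemma has_vector_derivative_transversal_integral:
  fixes A1 A2 :: "real^3 \<Rightarrow> 'v::euclidean_space"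
  assumes A1: "C1 A1" and A2: "C1 A2"
    and curl_free: "\<And>z. frechet_derivative A2 (at z) u = frechet_derivative A1 (at z) w"
  shows "((\<lambda>s. integral {0..1} (\<lambda>r. c *\<^sub>R A2 (y + s *\<^sub>R u + (r * c) *\<^sub>R w))) has_vector_derivative
           (A1 (y + s0 *\<^sub>R u + c *\<^sub>R w) - A1 (y + s0 *\<^sub>R u))) (at s0)"
proof -
  have "((\<lambda>s. c *\<^sub>R integral {0..1} (\<lambda>r. A2 (y + r *\<^sub>R (c *\<^sub>R w) + s *\<^sub>R u))) has_vector_derivative
      c *\<^sub>R integral {0..1} (\<lambda>r. frechet_derivative A2 (at (y + r *\<^sub>R (c *\<^sub>R w) + s0 *\<^sub>R u)) u)) (at s0)"
    by (rule bounded_linear.has_vector_derivative[OF bounded_linear_scaleR_right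
          has_vector_derivative_parametric_integral[OF A2]])
  moreover have "c *\<^sub>R frechet_derivative A1 (at z) w = frechet_derivative A1 (at z) (c *\<^sub>R w)" for z
    using has_derivative_bounded_linear[OF C1_has_derivative[OF A1]] by (simp add: linear_simps)
  ultimately have "((\<lambda>s. integral {0..1} (\<lambda>r. c *\<^sub>R A2 (y + s *\<^sub>R u + (r * c) *\<^sub>R w))) has_vector_derivative
      integral {0..1} (\<lambda>r. frechet_derivative A1 (at (y + s0 *\<^sub>R u + r *\<^sub>R (c *\<^sub>R w))) (c *\<^sub>R w))) (at s0)"
    by (simp add: curl_free algebra_simps flip: integral_cmul)
  then show ?thesis
    using integral_derivative_along_segment[OF A1, of "y + s0 *\<^sub>R u" "c *\<^sub>R w"] by simp
qed

lemma integral_in_subspace: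
  fixes f :: "real \<Rightarrow> 'a::euclidean_space"
  assumes S: "subspace S" and f: "\<And>t. f t \<in> S" and c: "continuous_on {a..b} f"
  shows "integral {a..b} f \<in> S"
proof -
  obtain p z where p: "p \<in> span S" and z: "\<And>w. w \<in> span S \<Longrightarrow> orthogonal z w"
    and yz: "integral {a..b} f = p + z"
    using orthogonal_subspace_decomp_exists[of S "integral {a..b} f"] by metis
  have i: "f integrable_on {a..b}" using c integrable_continuous_real by blast
  have sS: "span S = S" using S by (simp add: span_eq_iff)
  have "integral {a..b} ((\<lambda>v. z \<bullet> v) \<circ> f) = z \<bullet> integral {a..b} f"
    by (rule integral_linear[OF i bounded_linear_inner_right])
  moreover have "integral {a..b} ((\<lambda>v. z \<bullet> v) \<circ> f) = integral {a..b} (\<lambda>_. 0::real)"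
    using z f sS by (intro integral_cong) (auto simp: orthogonal_def)
  ultimately have "z \<bullet> integral {a..b} f = 0" by simp
  moreover have "z \<bullet> p = 0" using z[OF p] by (simp add: orthogonal_def)
  ultimately have "z \<bullet> z = 0" using yz by (simp add: inner_add_right)
  then have "z = 0" by simp
  then show ?thesis using yz p sS by simp
qed

definition base_point :: "real^3 \<Rightarrow> real^3" where
  "base_point x = x - x$1 *\<^sub>R axis 1 1 - x$2 *\<^sub>R axis 2 1"

lemma axis_12_nth [simp]:
  "(axis 1 1 :: real^3) $ 1 = 1" "(axis 1 1 :: real^3) $ 2 = 0"
  "(axis 2 1 :: real^3) $ 1 = 0" "(axis 2 1 :: real^3) $ 2 = 1"
  by (simp_all add: axis_def)

lemma base_point_decomp: "base_point x + x$1 *\<^sub>R axis 1 1 + x$2 *\<^sub>R axis 2 1 = x"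
  by (simp add: base_point_def)

lemma base_point_translate:
  "base_point (x + t *\<^sub>R axis 1 1) = base_point x" "base_point (x + t *\<^sub>R axis 2 1) = base_point x"
  by (simp_all add: base_point_def algebra_simps)

text \<open>The potential integrates \<open>A1\<close> along \<open>x\<^sup>1\<close> from the point \<open>base_point x\<close> of the \<open>x\<^sup>3\<close>-axis and
  then \<open>A2\<close> along \<open>x\<^sup>2\<close>; both segment integrals are rescaled to \<open>[0,1]\<close> so that they can be
  differentiated in the segment length.\<close>

definition planar_potential :: "(real^3 \<Rightarrow> 'v::euclidean_space) \<Rightarrow> (real^3 \<Rightarrow> 'v) \<Rightarrow> real^3 \<Rightarrow> 'v" where
  "planar_potential A1 A2 x =
     integral {0..1} (\<lambda>r. x$1 *\<^sub>R A1 (base_point x + (r * x$1) *\<^sub>R axis 1 1))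
   + integral {0..1} (\<lambda>r. x$2 *\<^sub>R A2 (base_point x + x$1 *\<^sub>R axis 1 1 + (r * x$2) *\<^sub>R axis 2 1))"

lemma planar_potential_in_subspace:
  assumes S: "subspace S" and A1: "\<And>z. A1 z \<in> S" "continuous_on UNIV A1"
    and A2: "\<And>z. A2 z \<in> S" "continuous_on UNIV A2"
  shows "planar_potential A1 A2 x \<in> S"
  unfolding planar_potential_def
  by (intro subspace_add[OF S] integral_in_subspace[OF S] subspace_scale[OF S] A1 A2
      continuous_on_compose2[OF A1(2)] continuous_on_compose2[OF A2(2)] continuous_intros) auto

lemma has_partial_1_planar_potential:
  assumes A1: "C1 A1" and A2: "C1 A2" and curl_free: "\<And>z. partial 2 A1 z = partial 1 A2 z"
  shows "has_partial 1 (planar_potential A1 A2) x (A1 x)"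
proof -
  let ?y = "base_point x"
  have curl_free': "frechet_derivative A2 (at z) (axis 1 1) = frechet_derivative A1 (at z) (axis 2 1)" for z
    using curl_free[of z] partial_eq_derivative[OF C1_has_derivative[OF A1]]
      partial_eq_derivative[OF C1_has_derivative[OF A2]] by simp
  have "((\<lambda>s. integral {0..1} (\<lambda>r. x$2 *\<^sub>R A2 (?y + s *\<^sub>R axis 1 1 + (r * x$2) *\<^sub>R axis 2 1)))
      has_vector_derivative A1 x - A1 (?y + x$1 *\<^sub>R axis 1 1)) (at (x$1))"
    using has_vector_derivative_transversal_integral[OF A1 A2 curl_free', of "x$2" ?y "x$1"]
    by (simp only: base_point_decomp)
  from has_vector_derivative_add[OF has_vector_derivative_integral_along_ray[OF A1, of ?y "axis 1 1" "x$1"] this]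
  have "((\<lambda>s. integral {0..1} (\<lambda>r. s *\<^sub>R A1 (?y + (r * s) *\<^sub>R axis 1 1))
      + integral {0..1} (\<lambda>r. x$2 *\<^sub>R A2 (?y + s *\<^sub>R axis 1 1 + (r * x$2) *\<^sub>R axis 2 1)))
      has_vector_derivative A1 x) (at (x$1))"
    by simp
  from has_vector_derivative_translate[where t=0, simplified, OF this]
  have "((\<lambda>t. integral {0..1} (\<lambda>r. (x$1 + t) *\<^sub>R A1 (?y + (r * (x$1 + t)) *\<^sub>R axis 1 1))
      + integral {0..1} (\<lambda>r. x$2 *\<^sub>R A2 (?y + (x$1 + t) *\<^sub>R axis 1 1 + (r * x$2) *\<^sub>R axis 2 1)))
      has_vector_derivative A1 x) (at 0)" .
  moreover have "planar_potential A1 A2 (x + t *\<^sub>R axis 1 1)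
    = integral {0..1} (\<lambda>r. (x$1 + t) *\<^sub>R A1 (?y + (r * (x$1 + t)) *\<^sub>R axis 1 1))
      + integral {0..1} (\<lambda>r. x$2 *\<^sub>R A2 (?y + (x$1 + t) *\<^sub>R axis 1 1 + (r * x$2) *\<^sub>R axis 2 1))" for t
    by (simp add: planar_potential_def base_point_translate)
  ultimately show ?thesis
    by (simp add: has_partial_def)
qed

lemma has_partial_2_planar_potential:
  assumes "C1 A2"
  shows "has_partial 2 (planar_potential A1 A2) x (A2 x)"
proof -
  let ?y = "base_point x + x$1 *\<^sub>R axis 1 1"
  have "((\<lambda>c. integral {0..1} (\<lambda>r. c *\<^sub>R A2 (?y + (r * c) *\<^sub>R axis 2 1))) has_vector_derivative A2 x)
      (at (x$2))"
    using has_vector_derivative_integral_along_ray[OF assms, of ?y "axis 2 1" "x$2"]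
    by (simp only: base_point_decomp)
  from has_vector_derivative_add[OF has_vector_derivative_const
      has_vector_derivative_translate[where t=0, simplified, OF this]]
  have "((\<lambda>t. integral {0..1} (\<lambda>r. x$1 *\<^sub>R A1 (base_point x + (r * x$1) *\<^sub>R axis 1 1))
      + integral {0..1} (\<lambda>r. (x$2 + t) *\<^sub>R A2 (?y + (r * (x$2 + t)) *\<^sub>R axis 2 1)))
      has_vector_derivative A2 x) (at 0)"
    by simp
  moreover have "planar_potential A1 A2 (x + t *\<^sub>R axis 2 1)
    = integral {0..1} (\<lambda>r. x$1 *\<^sub>R A1 (base_point x + (r * x$1) *\<^sub>R axis 1 1))
      + integral {0..1} (\<lambda>r. (x$2 + t) *\<^sub>R A2 (?y + (r * (x$2 + t)) *\<^sub>R axis 2 1))" for t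
    by (simp add: planar_potential_def base_point_translate)
  ultimately show ?thesis
    by (simp add: has_partial_def)
qed

lemma exists_potential:
  fixes A1 A2 :: "real^3 \<Rightarrow> 'v::euclidean_space"
  assumes A1: "C1 A1" and A2: "C1 A2" and curl_free: "\<And>z. partial 2 A1 z = partial 1 A2 z"
    and S: "subspace S" and S1: "\<And>z. A1 z \<in> S" and S2: "\<And>z. A2 z \<in> S"
  shows "\<exists>F. (\<forall>x. F x \<in> S) \<and> (\<forall>x. has_partial 1 F x (A1 x) \<and> has_partial 2 F x (A2 x))"
proof (intro exI conjI allI)
  show "planar_potential A1 A2 x \<in> S" for x
    by (rule planar_potential_in_subspace[OF S S1 C1_continuous[OF A1] S2 C1_continuous[OF A2]])
  show "has_partial 1 (planar_potential A1 A2) x (A1 x)" for x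
    by (rule has_partial_1_planar_potential[OF A1 A2 curl_free])
  show "has_partial 2 (planar_potential A1 A2) x (A2 x)" for x
    by (rule has_partial_2_planar_potential[OF A2])
qed

subsection \<open>Gauge transformation by the wave function\<close>

lemma conj_matrix_inv_eq_iff:
  assumes "invertible P"
  shows "matrix_inv P ** X ** P = matrix_inv P ** Y ** P \<longleftrightarrow> X = Y"
proof
  assume "matrix_inv P ** X ** P = matrix_inv P ** Y ** P"
  then have "P ** (matrix_inv P ** X ** P) ** matrix_inv P = P ** (matrix_inv P ** Y ** P) ** matrix_inv P"
    by simp
  then show "X = Y"
    by (simp add: matrix_mul_assoc matrix_inv_right[OF assms] flip: matrix_mul_assoc[of _ P])
qed simp

lemma has_partial_conj:
  fixes \<Phi> Q :: "real^3 \<Rightarrow> 'n::finite cmat"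
  assumes \<Phi>: "has_partial i \<Phi> x (a ** \<Phi> x)" and inv: "invertible (\<Phi> x)" and Q: "has_partial i Q x D"
  shows "has_partial i (\<lambda>y. matrix_inv (\<Phi> y) ** Q y ** \<Phi> y) x
      (matrix_inv (\<Phi> x) ** (D + lie_bracket (Q x) a) ** \<Phi> x)"
proof -
  let ?W = "matrix_inv (\<Phi> x)"
  have cancel: "X ** \<Phi> x ** ?W = X" for X
    by (simp flip: matrix_mul_assoc add: matrix_inv_right inv)
  have "has_partial i (\<lambda>y. matrix_inv (\<Phi> y) ** Q y ** \<Phi> y) x
      (?W ** Q x ** (a ** \<Phi> x) + (?W ** D + - (?W ** (a ** \<Phi> x) ** ?W) ** Q x) ** \<Phi> x)"
    by (intro has_partial_matrix_mult has_partial_matrix_inv \<Phi> Q inv)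
  moreover have "?W ** Q x ** (a ** \<Phi> x) + (?W ** D + - (?W ** (a ** \<Phi> x) ** ?W) ** Q x) ** \<Phi> x
      = ?W ** (D + lie_bracket (Q x) a) ** \<Phi> x"
    by (simp add: lie_bracket_def matrix_mult.add_left matrix_mult.add_right matrix_mult.diff_left
        matrix_mult.diff_right matrix_mult.minus_left matrix_mul_assoc cancel)
  ultimately show ?thesis by simp
qed

lemma has_partial_gauge_iff:
  fixes \<Phi> F :: "real^3 \<Rightarrow> 'a::{real_normed_field,euclidean_space}^'n::finite^'n"
  assumes \<Phi>: "has_partial i \<Phi> x (a ** \<Phi> x)" and inv: "\<And>y. invertible (\<Phi> y)"
  shows "has_partial i F x (matrix_inv (\<Phi> x) ** Q ** \<Phi> x)
    \<longleftrightarrow> has_partial i (\<lambda>y. \<Phi> y ** F y) x (a ** (\<Phi> x ** F x) + Q ** \<Phi> x)"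
proof
  assume "has_partial i F x (matrix_inv (\<Phi> x) ** Q ** \<Phi> x)"
  from has_partial_matrix_mult[OF \<Phi> this] show "has_partial i (\<lambda>y. \<Phi> y ** F y) x (a ** (\<Phi> x ** F x) + Q ** \<Phi> x)"
    by (simp add: matrix_mul_assoc matrix_inv_right inv add.commute)
next
  assume \<Psi>: "has_partial i (\<lambda>y. \<Phi> y ** F y) x (a ** (\<Phi> x ** F x) + Q ** \<Phi> x)"
  have F: "F = (\<lambda>y. matrix_inv (\<Phi> y) ** (\<Phi> y ** F y))"
    by (simp add: matrix_mul_assoc matrix_inv_left inv)
  have cancel: "X ** \<Phi> x ** matrix_inv (\<Phi> x) = X" for X
    by (simp flip: matrix_mul_assoc add: matrix_inv_right inv)
  show "has_partial i F x (matrix_inv (\<Phi> x) ** Q ** \<Phi> x)"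
    using has_partial_matrix_mult[OF has_partial_matrix_inv[OF \<Phi> inv] \<Psi>]
    by (subst F) (simp add: matrix_mult.add_right matrix_mult.minus_left matrix_mul_assoc cancel)
qed

lemma sym_condition_iff_conj_curl_free:
  fixes \<Phi> u1 u2 Q1 Q2 :: "real^3 \<Rightarrow> 'n::finite cmat"
  assumes \<Phi>1: "\<And>x. has_partial 1 \<Phi> x (u1 x ** \<Phi> x)" and \<Phi>2: "\<And>x. has_partial 2 \<Phi> x (u2 x ** \<Phi> x)"
    and inv: "\<And>x. invertible (\<Phi> x)" and Q1: "C1 Q1" and Q2: "C1 Q2"
  shows "sym_condition u1 u2 Q1 Q2 \<longleftrightarrow>
    (\<forall>x. partial 2 (\<lambda>y. matrix_inv (\<Phi> y) ** Q1 y ** \<Phi> y) x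
       = partial 1 (\<lambda>y. matrix_inv (\<Phi> y) ** Q2 y ** \<Phi> y) x)"
proof -
  have "partial 2 (\<lambda>y. matrix_inv (\<Phi> y) ** Q1 y ** \<Phi> y) x
      = partial 1 (\<lambda>y. matrix_inv (\<Phi> y) ** Q2 y ** \<Phi> y) x
    \<longleftrightarrow> partial 2 Q1 x - partial 1 Q2 x + lie_bracket (Q1 x) (u2 x) + lie_bracket (u1 x) (Q2 x) = 0" for x
  proof -
    have "partial 2 (\<lambda>y. matrix_inv (\<Phi> y) ** Q1 y ** \<Phi> y) x
        = matrix_inv (\<Phi> x) ** (partial 2 Q1 x + lie_bracket (Q1 x) (u2 x)) ** \<Phi> x"
      and "partial 1 (\<lambda>y. matrix_inv (\<Phi> y) ** Q2 y ** \<Phi> y) x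
        = matrix_inv (\<Phi> x) ** (partial 1 Q2 x + lie_bracket (Q2 x) (u1 x)) ** \<Phi> x"
      by (intro partial_eqI has_partial_conj \<Phi>1 \<Phi>2 inv C1_has_partial Q1 Q2)+
    then show ?thesis
      by (simp add: conj_matrix_inv_eq_iff inv lie_bracket_def algebra_simps)
  qed
  then show ?thesis
    unfolding sym_condition_def by blast
qed

theorem proposition1:
  fixes G :: "'n::finite cmat set"
    and u1 u2 \<Phi> Q1 Q2 :: "real^3 \<Rightarrow> 'n cmat"
  assumes G: "matrix_Lie_group G"
    and u_g: "\<forall>x. u1 x \<in> lie_algebra G \<and> u2 x \<in> lie_algebra G"
    and u_C1: "C1 u1" "C1 u2"
    and Delta: "\<forall>x. partial 2 u1 x - partial 1 u2 x + lie_bracket (u1 x) (u2 x) = 0"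
    and \<Phi>_G: "\<forall>x. \<Phi> x \<in> G"
    and \<Phi>_C1: "C1 \<Phi>"
    and LSP: "\<forall>x. partial 1 \<Phi> x = u1 x ** \<Phi> x \<and> partial 2 \<Phi> x = u2 x ** \<Phi> x"
    and Q_g: "\<forall>x. Q1 x \<in> lie_algebra G \<and> Q2 x \<in> lie_algebra G"
    and Q_C1: "C1 Q1" "C1 Q2"
  shows
   "(sym_condition u1 u2 Q1 Q2
      \<longleftrightarrow> (\<exists>F. (\<forall>x. F x \<in> lie_algebra G) \<and>
               (\<forall>x. has_partial 1 F x (matrix_inv (\<Phi> x) ** Q1 x ** \<Phi> x) \<and>
                    has_partial 2 F x (matrix_inv (\<Phi> x) ** Q2 x ** \<Phi> x))))
    \<and> (sym_condition u1 u2 Q1 Q2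
      \<longleftrightarrow> (\<exists>\<Psi>. sym_condition u1 u2 Q1 Q2 \<and>
               (\<forall>x. matrix_inv (\<Phi> x) ** \<Psi> x \<in> lie_algebra G) \<and>
               (\<forall>x. has_partial 1 \<Psi> x (u1 x ** \<Psi> x + Q1 x ** \<Phi> x) \<and>
                    has_partial 2 \<Psi> x (u2 x ** \<Psi> x + Q2 x ** \<Phi> x))))
    \<and> (\<forall>F. ((\<forall>x. F x \<in> lie_algebra G) \<and>
               (\<forall>x. has_partial 1 F x (matrix_inv (\<Phi> x) ** Q1 x ** \<Phi> x) \<and>
                    has_partial 2 F x (matrix_inv (\<Phi> x) ** Q2 x ** \<Phi> x)))
         \<longrightarrow> (let \<Psi> = (\<lambda>x. \<Phi> x ** F x) in
               sym_condition u1 u2 Q1 Q2 \<and>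
               (\<forall>x. matrix_inv (\<Phi> x) ** \<Psi> x \<in> lie_algebra G) \<and>
               (\<forall>x. has_partial 1 \<Psi> x (u1 x ** \<Psi> x + Q1 x ** \<Phi> x) \<and>
                    has_partial 2 \<Psi> x (u2 x ** \<Psi> x + Q2 x ** \<Phi> x))))
    \<and> (\<forall>\<Psi>. (sym_condition u1 u2 Q1 Q2 \<and>
               (\<forall>x. matrix_inv (\<Phi> x) ** \<Psi> x \<in> lie_algebra G) \<and>
               (\<forall>x. has_partial 1 \<Psi> x (u1 x ** \<Psi> x + Q1 x ** \<Phi> x) \<and>
                    has_partial 2 \<Psi> x (u2 x ** \<Psi> x + Q2 x ** \<Phi> x)))
         \<longrightarrow> (let F = (\<lambda>x. matrix_inv (\<Phi> x) ** \<Psi> x) in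
               (\<forall>x. F x \<in> lie_algebra G) \<and>
               (\<forall>x. has_partial 1 F x (matrix_inv (\<Phi> x) ** Q1 x ** \<Phi> x) \<and>
                    has_partial 2 F x (matrix_inv (\<Phi> x) ** Q2 x ** \<Phi> x))))"
proof -
  \<comment> \<open>The zero-curvature equation \<open>Delta\<close> is the compatibility condition of the LSP.\<close>
  define A1 where "A1 x = matrix_inv (\<Phi> x) ** Q1 x ** \<Phi> x" for x
  define A2 where "A2 x = matrix_inv (\<Phi> x) ** Q2 x ** \<Phi> x" for x
  have inv: "invertible (\<Phi> x)" for x
    using matrix_Lie_group_invertible G \<Phi>_G by blast
  have \<Phi>1: "has_partial 1 \<Phi> x (u1 x ** \<Phi> x)" and \<Phi>2: "has_partial 2 \<Phi> x (u2 x ** \<Phi> x)" for x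
    using C1_has_partial[OF \<Phi>_C1] LSP by metis+
  have A_g: "A1 x \<in> lie_algebra G" "A2 x \<in> lie_algebra G" for x
    unfolding A1_def A2_def using lie_algebra_conj G Q_g \<Phi>_G by blast+
  have A_C1: "C1 A1" "C1 A2"
    unfolding A1_def A2_def
    by (intro C1_matrix_mult C1_matrix_inv \<Phi>_C1 Q_C1 inv)+
  have sym_iff: "sym_condition u1 u2 Q1 Q2 \<longleftrightarrow> (\<forall>x. partial 2 A1 x = partial 1 A2 x)"
    unfolding A1_def A2_def
    by (rule sym_condition_iff_conj_curl_free[OF \<Phi>1 \<Phi>2 inv Q_C1])
  have potential_iff: "(\<exists>F. (\<forall>x. F x \<in> lie_algebra G) \<and>
        (\<forall>x. has_partial 1 F x (A1 x) \<and> has_partial 2 F x (A2 x)))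
      \<longleftrightarrow> (\<forall>x. partial 2 A1 x = partial 1 A2 x)"
    using mixed_partials_commute[OF _ _ A_C1] exists_potential[OF A_C1 _ lie_algebra_subspace[OF G] A_g]
    by metis
  have gauge: "has_partial 1 F x (A1 x) \<longleftrightarrow> has_partial 1 (\<lambda>y. \<Phi> y ** F y) x (u1 x ** (\<Phi> x ** F x) + Q1 x ** \<Phi> x)"
    "has_partial 2 F x (A2 x) \<longleftrightarrow> has_partial 2 (\<lambda>y. \<Phi> y ** F y) x (u2 x ** (\<Phi> x ** F x) + Q2 x ** \<Phi> x)" for F x
    unfolding A1_def A2_def by (intro has_partial_gauge_iff \<Phi>1 \<Phi>2 inv)+
  have \<Phi>_cancel: "matrix_inv (\<Phi> x) ** (\<Phi> x ** M) = M" "\<Phi> x ** (matrix_inv (\<Phi> x) ** M) = M" for x M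
    by (simp_all add: matrix_mul_assoc matrix_inv_left matrix_inv_right inv)
  have deformation_of_immersion: "\<exists>\<Psi>. (\<forall>x. matrix_inv (\<Phi> x) ** \<Psi> x \<in> lie_algebra G) \<and>
      (\<forall>x. has_partial 1 \<Psi> x (u1 x ** \<Psi> x + Q1 x ** \<Phi> x) \<and> has_partial 2 \<Psi> x (u2 x ** \<Psi> x + Q2 x ** \<Phi> x))"
    if "\<forall>x. F x \<in> lie_algebra G" "\<forall>x. has_partial 1 F x (A1 x) \<and> has_partial 2 F x (A2 x)" for F
    using that by (intro exI[of _ "\<lambda>y. \<Phi> y ** F y"]) (simp add: \<Phi>_cancel gauge)
  show ?thesis
    unfolding Let_def A1_def[symmetric] A2_def[symmetric]
    using sym_iff potential_iff deformation_of_immersion by (auto simp: \<Phi>_cancel gauge)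
qed

end
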